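(* Let $k$ and $N$ be positive integers. Then $$f(k,N)\leq 2k\left(\left\lfloor \frac{N}{k} \right\rfloor-1 \right)+1.$$
   Context: Let $k,N$ be fixed positive integers and let $A,B$ be disjoint sets with $|A|=|B|=N$. For $S\subset A\cup B$ write $S_A=S\cap A$ and $S_B=S\cap B$. A family $\mathcal{S}$ of subsets of $A\cup B$ is called semiintersecting (with constants $k$ and $N$) if (i) $|S_A|=|S_B|=k$ for all $S\in\mathcal{S}$, and (ii) for all $S\neq T$ in $\mathcal{S}$, $S_A\cap T_A=\emptyset$ if and only if $S_B\cap T_B\neq\emptyset$. Define $f(k,N)$ to be the maximum of $|\mathcal{S}|$ over all semiintersecting families $\mathcal{S}$ with constants $k$ and $N$.
   Formalization: The bound is proved under the additional assumption k ≤ N; for N < k only the empty family is semiintersecting, so f(k,N) = 0 while the right side is 1 − 2k < 0 and the stated bound fails. *)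

theory Defs
  imports Complex_Main
begin

definition semiintersecting :: "'a set \<Rightarrow> 'a set \<Rightarrow> nat \<Rightarrow> 'a set set \<Rightarrow> bool" where
  "semiintersecting A B k F \<longleftrightarrow>
     F \<subseteq> Pow (A \<union> B) \<and>
     (\<forall>S\<in>F. card (S \<inter> A) = k \<and> card (S \<inter> B) = k) \<and>
     (\<forall>S\<in>F. \<forall>T\<in>F. S \<noteq> T \<longrightarrow>
        ((S \<inter> A) \<inter> (T \<inter> A) = {} \<longleftrightarrow> (S \<inter> B) \<inter> (T \<inter> B) \<noteq> {}))"

text \<open>
  The number \<open>f(k, N)\<close>, computed in a given pair of disjoint ground sets \<open>A\<close> and \<open>B\<close> with
  \<open>N\<close> elements each; up to a bijection of the ground sets it depends on \<open>k\<close> and \<open>N\<close> only.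
  For finite \<open>A\<close> and \<open>B\<close>, the set of which \<^const>\<open>Max\<close> is taken is finite and nonempty, so
  this is a genuine maximum (see \<open>max_semiintersecting_attained\<close> and
  \<open>max_semiintersecting_upper\<close>).
\<close>

definition max_semiintersecting :: "'a set \<Rightarrow> 'a set \<Rightarrow> nat \<Rightarrow> nat" where
  "max_semiintersecting A B k = Max {card F |F. semiintersecting A B k F}"

lemma finite_semiintersecting_cards:
  assumes "finite A" "finite B"
  shows "finite {card F |F. semiintersecting A B k F}"
proof -
  have "{card F |F. semiintersecting A B k F} \<subseteq> card ` Pow (Pow (A \<union> B))"
    by (auto simp: semiintersecting_def)
  then show ?thesis
    using assms by (meson finite_Pow_iff finite_UnI finite_imageI finite_subset)
qed

lemma max_semiintersecting_attained:
  assumes "finite A" "finite B"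
  shows "\<exists>F. semiintersecting A B k F \<and> card F = max_semiintersecting A B k"
proof -
  have "semiintersecting A B k {}"
    by (simp add: semiintersecting_def)
  then have "{card F |F. semiintersecting A B k F} \<noteq> {}"
    by blast
  from Max_in[OF finite_semiintersecting_cards[OF assms] this] show ?thesis
    by (auto simp: max_semiintersecting_def)
qed

lemma max_semiintersecting_upper:
  assumes "finite A" "finite B" "semiintersecting A B k F"
  shows "card F \<le> max_semiintersecting A B k"
  unfolding max_semiintersecting_def
  using assms by (intro Max_ge finite_semiintersecting_cards) auto

end

theory Submission
  imports Defs
begin

text \<open>
  Fix a member \<open>S\<close> of the family. Every other member meets \<open>S\<close> in \<open>A\<close> or in \<open>B\<close>, so it is
  enough to bound each kind by \<open>k (N div k - 1)\<close>. Members that share a point of \<open>A\<close> meet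
  pairwise in \<open>A\<close>, hence are pairwise disjoint in \<open>B\<close>, and only \<open>N div k\<close> disjoint
  \<open>k\<close>-sets fit into \<open>B\<close>. So each of the \<open>k\<close> points of \<open>S \<inter> A\<close> lies in at most
  \<open>N div k - 1\<close> members besides \<open>S\<close>, which bounds the members meeting \<open>S\<close> in \<open>A\<close>. The
  condition is symmetric in \<open>A\<close> and \<open>B\<close>, so the same bound holds for those meeting \<open>S\<close>
  in \<open>B\<close>.
\<close>

lemma semiintersecting_swap:
  assumes "semiintersecting A B k F"
  shows "semiintersecting B A k F"
  using assms unfolding semiintersecting_def by (simp add: Un_commute)

lemma card_disjoint_traces_le_div:
  assumes "k > 0" and "finite B" and "finite G"
    and "\<And>T. T \<in> G \<Longrightarrow> card (T \<inter> B) = k"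
    and "\<And>T U. \<lbrakk>T \<in> G; U \<in> G; T \<noteq> U\<rbrakk> \<Longrightarrow> (T \<inter> B) \<inter> (U \<inter> B) = {}"
  shows "card G \<le> card B div k"
proof -
  have "card G * k = card (\<Union>T\<in>G. T \<inter> B)"
    using assms by (subst card_UN_disjoint) auto
  also have "\<dots> \<le> card B"
    using assms(2) by (intro card_mono) auto
  finally show ?thesis
    using assms(1) by (simp add: less_eq_div_iff_mult_less_eq)
qed

text \<open>
  Counted with \<open>S\<close> itself, the members through a point of \<open>S \<inter> A\<close> have pairwise disjoint
  traces on \<open>B\<close>.
\<close>

lemma card_meeting_first_part_le:
  assumes "k > 0" and "finite B" and "finite F"
    and "semiintersecting A B k F" and "S \<in> F"
  shows "card {T \<in> F - {S}. (S \<inter> A) \<inter> (T \<inter> A) \<noteq> {}} \<le> k * (card B div k - 1)"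
proof -
  have trace: "card (T \<inter> A) = k" "card (T \<inter> B) = k" if "T \<in> F" for T
    using assms(4) that by (auto simp: semiintersecting_def)
  have disjoint_B: "(T \<inter> B) \<inter> (U \<inter> B) = {}"
    if "T \<in> F" "U \<in> F" "T \<noteq> U" "a \<in> T \<inter> A" "a \<in> U \<inter> A" for T U a
    using assms(4) that unfolding semiintersecting_def by blast
  have finite_trace: "finite (S \<inter> A)"
    using trace(1)[OF assms(5)] assms(1) by (intro card_ge_0_finite) simp
  have through: "card {T \<in> F - {S}. a \<in> T} \<le> card B div k - 1" if "a \<in> S \<inter> A" for a
  proof -
    have "card {T \<in> F. a \<in> T} \<le> card B div k"
    proof (rule card_disjoint_traces_le_div[OF assms(1,2)])
      show "(T \<inter> B) \<inter> (U \<inter> B) = {}"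
        if "T \<in> {T \<in> F. a \<in> T}" "U \<in> {T \<in> F. a \<in> T}" "T \<noteq> U" for T U
        using that \<open>a \<in> S \<inter> A\<close> by (intro disjoint_B[of T U a]) auto
    qed (use assms(3) trace in auto)
    moreover have "{T \<in> F - {S}. a \<in> T} = {T \<in> F. a \<in> T} - {S}"
      by auto
    ultimately show ?thesis
      using that assms(3,5) by (simp add: card_Diff_singleton)
  qed
  have "{T \<in> F - {S}. (S \<inter> A) \<inter> (T \<inter> A) \<noteq> {}} = (\<Union>a\<in>S \<inter> A. {T \<in> F - {S}. a \<in> T})"
    by auto
  also have "card \<dots> \<le> (\<Sum>a\<in>S \<inter> A. card {T \<in> F - {S}. a \<in> T})"
    by (rule card_UN_le[OF finite_trace])
  also have "\<dots> \<le> card (S \<inter> A) * (card B div k - 1)"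
    using sum_bounded_above[of "S \<inter> A", OF through] by simp
  finally show ?thesis
    using trace(1)[OF assms(5)] by simp
qed

lemma card_semiintersecting_le:
  assumes "k > 0" and "finite A" and "finite B" and "semiintersecting A B k F"
  shows "card F \<le> k * (card A div k - 1) + k * (card B div k - 1) + 1"
proof (cases "F = {}")
  case False
  then obtain S where S: "S \<in> F" by blast
  let ?FA = "{T \<in> F - {S}. (S \<inter> A) \<inter> (T \<inter> A) \<noteq> {}}"
  let ?FB = "{T \<in> F - {S}. (S \<inter> B) \<inter> (T \<inter> B) \<noteq> {}}"
  have fin: "finite F"
    using assms by (auto simp: semiintersecting_def intro: finite_subset)
  have "T \<in> ?FA \<union> ?FB" if "T \<in> F" "T \<noteq> S" for T
    using assms(4) S that unfolding semiintersecting_def by blast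
  then have "F = insert S (?FA \<union> ?FB)"
    using S by blast
  then have "card F \<le> card (?FA \<union> ?FB) + 1"
    using card_insert_le_m1[of "card (?FA \<union> ?FB) + 1" "?FA \<union> ?FB" S] by simp
  also have "card (?FA \<union> ?FB) \<le> card ?FA + card ?FB"
    by (rule card_Un_le)
  also have "card ?FA \<le> k * (card B div k - 1)"
    by (rule card_meeting_first_part_le[OF assms(1,3) fin assms(4) S])
  also have "card ?FB \<le> k * (card A div k - 1)"
    by (rule card_meeting_first_part_le
        [OF assms(1,2) fin semiintersecting_swap[OF assms(4)] S])
  finally show ?thesis by simp
qed simp

theorem lemma2p1:
  fixes k N :: nat and A B :: "'a set"
  assumes "k > 0" and "N > 0" and "k \<le> N"
    and "A \<inter> B = {}" and "card A = N" and "card B = N"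
  shows "int (max_semiintersecting A B k)
           \<le> 2 * int k * (\<lfloor>real N / real k\<rfloor> - 1) + 1"
proof -
  have fin: "finite A" "finite B"
    using assms by (auto intro: card_ge_0_finite)
  obtain F where F: "semiintersecting A B k F" "card F = max_semiintersecting A B k"
    using max_semiintersecting_attained[OF fin] by blast
  have "max_semiintersecting A B k \<le> 2 * k * (N div k - 1) + 1"
    using card_semiintersecting_le[OF assms(1) fin F(1)] F(2) assms(5,6) by simp
  then have "int (max_semiintersecting A B k) \<le> int (2 * k * (N div k - 1) + 1)"
    by (simp only: of_nat_le_iff)
  \<comment> \<open>The truncated subtraction is exact because \<open>k \<le> N\<close>.\<close>
  also have "\<dots> = 2 * int k * (int (N div k) - 1) + 1"
    using assms(1,3) by (simp add: of_nat_diff Suc_le_eq div_greater_zero_iff)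
  also have "int (N div k) = \<lfloor>real N / real k\<rfloor>"
    by (simp add: floor_divide_of_nat_eq)
  finally show ?thesis .
qed

end
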